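(* Let $G$ be a nontrivial connected graph whose complement $\overline{G}$ is triangle-free. Then $rc(G)\leq 6$.
   Context: All graphs are finite, undirected and simple. For an edge-coloring $c:E(G)\to\{1,\dots,k\}$ (adjacent edges may receive the same color), a path is rainbow if no two of its edges have the same color; $G$ is rainbow connected under $c$ if every two vertices are joined by a rainbow path. The rainbow connection number $rc(G)$ of a nontrivial connected graph $G$ is the minimum $k$ for which such a coloring with $k$ colors exists. $\overline{G}$ denotes the complement of $G$. *)

theory Defs
  imports "Graph_Theory.Graph_Theory"
begin

text \<open>
  A finite simple undirected graph is a \<^locale>\<open>pair_graph\<close>: a finite vertex set with a
  symmetric, irreflexive set of arcs, so that the undirected edge \<open>uv\<close> is the pair of
  arcs \<open>(u, v)\<close> and \<open>(v, u)\<close>. Edge colourings are functions of the two-element set \<open>{u, v}\<close>,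
  hence give both arcs the same colour.
\<close>

definition edges :: "'a pair_pre_digraph \<Rightarrow> 'a set set" where
  "edges G = {{u, v} | u v. (u, v) \<in> parcs G}"

definition complement :: "'a pair_pre_digraph \<Rightarrow> 'a pair_pre_digraph" where
  "complement G = \<lparr> pverts = pverts G,
     parcs = {(u, v). u \<in> pverts G \<and> v \<in> pverts G \<and> u \<noteq> v \<and> (u, v) \<notin> parcs G} \<rparr>"

definition triangle_free :: "'a pair_pre_digraph \<Rightarrow> bool" where
  "triangle_free G \<longleftrightarrow>
     \<not> (\<exists>u v w. {u, v} \<in> edges G \<and> {v, w} \<in> edges G \<and> {u, w} \<in> edges G
          \<and> u \<noteq> v \<and> v \<noteq> w \<and> u \<noteq> w)"

definition edge_coloring :: "'a pair_pre_digraph \<Rightarrow> nat \<Rightarrow> ('a set \<Rightarrow> nat) \<Rightarrow> bool" where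
  "edge_coloring G k c \<longleftrightarrow> c ` edges G \<subseteq> {1..k}"

definition rainbow_path ::
  "'a pair_pre_digraph \<Rightarrow> ('a set \<Rightarrow> nat) \<Rightarrow> 'a \<Rightarrow> ('a \<times> 'a) awalk \<Rightarrow> 'a \<Rightarrow> bool" where
  "rainbow_path G c u p v \<longleftrightarrow>
     pre_digraph.apath (with_proj G) u p v \<and> distinct (map (\<lambda>e. c {fst e, snd e}) p)"

definition rainbow_connected :: "'a pair_pre_digraph \<Rightarrow> ('a set \<Rightarrow> nat) \<Rightarrow> bool" where
  "rainbow_connected G c \<longleftrightarrow>
     (\<forall>u \<in> pverts G. \<forall>v \<in> pverts G. \<exists>p. rainbow_path G c u p v)"

text \<open>Only meaningful for connected \<open>G\<close>, where the minimum is attained.\<close>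

definition rc :: "'a pair_pre_digraph \<Rightarrow> nat" where
  "rc G = (LEAST k. \<exists>c. edge_coloring G k c \<and> rainbow_connected G c)"

lemma pair_graph_complement:
  assumes "pair_graph G"
  shows "pair_graph (complement G)"
proof -
  interpret pair_graph G by fact
  have "parcs (complement G) \<subseteq> pverts G \<times> pverts G"
    by (auto simp: complement_def)
  then have "finite (parcs (complement G))"
    using pair_finite_verts by (meson finite_SigmaI finite_subset)
  moreover have "(v, u) \<in> parcs G" if "(u, v) \<in> parcs G" for u v
    using that pair_sym_arcs by (auto simp: symmetric_def sym_def)
  ultimately show ?thesis
    using pair_finite_verts
    by unfold_locales (auto simp: complement_def symmetric_def sym_def)
qed

lemma distinct_edges_apath:
  assumes "pcas u p v" "distinct (pawalk_verts u p)"
  shows "distinct (map (\<lambda>e. {fst e, snd e}) p)"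
  using assms
proof (induction p arbitrary: u)
  case (Cons e p)
  have sub: "{fst f, snd f} \<subseteq> set (pawalk_verts w q)"
    if "f \<in> set q" "pcas w q v" for f w q
    using that
  proof (induction q arbitrary: w)
    case (Cons g q)
    have "snd g \<in> set (pawalk_verts (snd g) q)" by (cases q) (use Cons.prems in auto)
    with Cons show ?case by fastforce
  qed simp
  have "{fst e, snd e} \<noteq> {fst f, snd f}" if "f \<in> set p" for f
    using sub[OF that, of "snd e"] Cons.prems by (auto simp: doubleton_eq_iff)
  with Cons show ?case by auto
qed simp

lemma rc_attained:
  assumes "pair_graph G" "connected (with_proj G)"
  shows "\<exists>c. edge_coloring G (rc G) c \<and> rainbow_connected G c"
proof -
  interpret pair_graph G by fact
  have "edges G = (\<lambda>e. {fst e, snd e}) ` parcs G"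
    by (force simp: edges_def)
  then have "finite (edges G)" using pair_finite_arcs by simp
  then obtain f :: "'a set \<Rightarrow> nat" and n where f: "f ` edges G = {i. i < n}" "inj_on f (edges G)"
    using finite_imp_inj_to_nat_seg by metis
  let ?c = "Suc \<circ> f"
  have "edge_coloring G n ?c"
    unfolding edge_coloring_def using f(1) by (auto simp: Suc_le_eq)
  moreover have "rainbow_connected G ?c"
    unfolding rainbow_connected_def
  proof (intro ballI)
    fix u v assume uv: "u \<in> pverts G" "v \<in> pverts G"
    then obtain r where "pre_digraph.awalk (with_proj (mk_symmetric (with_proj G))) u r v"
      using connected_awalkE[OF assms(2)] by blast
    then obtain q where "awalk u q v"
      using mk_symmetric_awalk_imp_awalk[OF pair_sym_arcs] by blast
    then have "\<exists>p. apath u p v"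
      using apath_awalk_to_apath by blast
    then obtain p where p: "apath u p v" by blast
    then have d: "distinct (map (\<lambda>e. {fst e, snd e}) p)" and "set p \<subseteq> parcs G"
      using distinct_edges_apath[of u p v] by (auto simp: apath_def awalk_def)
    then have "set (map (\<lambda>e. {fst e, snd e}) p) \<subseteq> edges G"
      by (force simp: edges_def)
    then have "inj_on ?c (set (map (\<lambda>e. {fst e, snd e}) p))"
      using f(2) by (meson comp_inj_on inj_Suc inj_on_subset subset_UNIV)
    then have "distinct (map ?c (map (\<lambda>e. {fst e, snd e}) p))"
      using d by (simp only: distinct_map)
    then have "distinct (map (\<lambda>e. ?c {fst e, snd e}) p)"
      by (simp only: map_map comp_def)
    with p show "\<exists>p. rainbow_path G ?c u p v"
      unfolding rainbow_path_def by blast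
  qed
  ultimately have "\<exists>k c. edge_coloring G k c \<and> rainbow_connected G c" by blast
  then show ?thesis
    unfolding rc_def by (rule LeastI_ex)
qed

end

theory Submission
  imports Defs
begin

text \<open>
  If \<open>G\<close> is not complete, connectedness gives non-adjacent vertices \<open>u\<close>, \<open>v\<close> with a common
  neighbour \<open>w\<close>. As the complement has no triangle, every other vertex is adjacent to \<open>u\<close> or
  \<open>v\<close>, and the vertices adjacent to only one of them form, for each of the two, a clique. Give
  \<open>uw\<close> and \<open>vw\<close> the colours 1 and 2, the edges from \<open>u\<close> and from \<open>v\<close> to the remaining common
  neighbours the colours 3 and 4, the remaining edges at \<open>u\<close> the colour 5, and everything else
  the colour 6. Any two non-adjacent vertices are then joined by a rainbow path along
  \<open>u\<close>, \<open>w\<close>, \<open>v\<close>.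
\<close>

context pair_graph
begin

text \<open>Colours belong to unordered pairs, so reversing a path only reverses its list of
  colours.\<close>

lemma rainbow_path_sym:
  assumes "rainbow_path G c x p y"
  shows "rainbow_path G c y (rev_path p) x"
proof -
  have "map (\<lambda>e. c {fst e, snd e}) (rev_path p) = rev (map (\<lambda>e. c {fst e, snd e}) p)"
    by (induction p) (auto simp: insert_commute)
  moreover have "awalk x p y"
    using assms by (simp add: rainbow_path_def apath_def)
  ultimately show ?thesis
    using assms unfolding rainbow_path_def
    by (simp add: apath_def awalk_verts_rev_path)
qed

text \<open>Peeling off the first arc lets the simplifier check paths written out arc by
  arc.\<close>

lemma rainbow_path_simps:
  "rainbow_path G c x [] y \<longleftrightarrow> x = y \<and> x \<in> pverts G"
  "rainbow_path G c x ((a, b) # p) y \<longleftrightarrow>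
     a = x \<and> (x, b) \<in> parcs G \<and> x \<notin> set (pawalk_verts b p) \<and>
     c {x, b} \<notin> (\<lambda>e. c {fst e, snd e}) ` set p \<and> rainbow_path G c b p y"
  by (auto simp: rainbow_path_def apath_simps awalk_verts_conv)

text \<open>Without such a triple, being equal or adjacent is transitive, so any walk from
  \<open>x\<close> to \<open>y\<close> collapses to a single arc or to a point.\<close>

lemma connected_obtain_common_neighbour:
  assumes "Digraph_Component.connected (with_proj G)"
    and "x \<in> pverts G" "y \<in> pverts G" "x \<noteq> y" "(x, y) \<notin> parcs G"
  obtains u w v where "(u, w) \<in> parcs G" "(w, v) \<in> parcs G" "u \<noteq> v" "(u, v) \<notin> parcs G"
proof (rule ccontr)
  assume no: "\<not> thesis"
  obtain r where "pre_digraph.awalk (with_proj (mk_symmetric (with_proj G))) x r y"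
    using connected_awalkE[OF assms(1)] assms(2,3) by blast
  then obtain q where "awalk x q y"
    using mk_symmetric_awalk_imp_awalk[OF pair_sym_arcs] by blast
  then have "x = y \<or> (x, y) \<in> parcs G"
  proof (induction q arbitrary: x)
    case (Cons e q)
    then have "(x, snd e) \<in> parcs G" "awalk (snd e) q y"
      by (auto simp: awalk_Cons_iff)
    then show ?case using Cons.IH that no by blast
  qed (auto simp: awalk_Nil_iff)
  then show False using assms(4,5) by blast
qed

lemma rainbow_connected_six_colours:
  assumes tri: "triangle_free (complement G)"
    and uw: "(u, w) \<in> parcs G" and wv: "(w, v) \<in> parcs G"
    and uv: "u \<noteq> v" "(u, v) \<notin> parcs G"
  shows "\<exists>c. edge_coloring G 6 c \<and> rainbow_connected G c"
proof -
  have sym: "(b, a) \<in> parcs G" if "(a, b) \<in> parcs G" for a b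
    using that by (rule arcs_symmetric)
  have irrefl: "a \<noteq> b" if "(a, b) \<in> parcs G" for a b
    using that no_loops' by auto
  have vert: "a \<in> pverts G" "b \<in> pverts G" if "(a, b) \<in> parcs G" for a b
    using that by (auto dest: in_arcsD1 in_arcsD2)
  have indep: "(a, b) \<in> parcs G \<or> (a, d) \<in> parcs G \<or> (b, d) \<in> parcs G"
    if "a \<in> pverts G" "b \<in> pverts G" "d \<in> pverts G" "a \<noteq> b" "a \<noteq> d" "b \<noteq> d" for a b d
    using tri that unfolding triangle_free_def edges_def complement_def by fastforce
  \<comment> \<open>The clauses for \<open>{u, w}\<close> and \<open>{v, w}\<close> come first
    because \<open>w\<close> is itself a common neighbour. As \<open>u\<close> and \<open>v\<close>
    are non-adjacent, the \<open>x\<close> in the clauses for 3 and 4 can only be the other end of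
    the edge.\<close>
  define c :: "'a set \<Rightarrow> nat" where "c e =
    (if e = {u, w} then 1 else if e = {v, w} then 2
     else if u \<in> e \<and> (\<exists>x\<in>e. (x, v) \<in> parcs G) then 3
     else if v \<in> e \<and> (\<exists>x\<in>e. (x, u) \<in> parcs G) then 4
     else if u \<in> e then 5 else 6)" for e
  define conn where "conn x y \<longleftrightarrow> (\<exists>p. rainbow_path G c x p y)" for x y
  have conn_sym: "conn y x" if "conn x y" for x y
    using that rainbow_path_sym unfolding conn_def by blast
  have conn_arc: "conn x y" if "(x, y) \<in> parcs G" for x y
  proof -
    have "rainbow_path G c x [(x, y)] y"
      using that irrefl vert by (auto simp: rainbow_path_simps)
    then show ?thesis unfolding conn_def by blast
  qed
  have basic: "u \<noteq> w" "w \<noteq> u" "v \<noteq> w" "w \<noteq> v" "v \<noteq> u" "u \<in> pverts G" "v \<in> pverts G" "w \<in> pverts G"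
    "(w, u) \<in> parcs G" "(v, w) \<in> parcs G" "(v, u) \<notin> parcs G" "(u, u) \<notin> parcs G" "(v, v) \<notin> parcs G"
    using uw wv uv irrefl vert sym by blast+
  note facts = basic uw wv uv
  have c_uw: "c {u, w} = 1" "c {w, u} = 1" and c_wv: "c {w, v} = 2" "c {v, w} = 2"
    using facts by (auto simp: c_def doubleton_eq_iff)
  \<comment> \<open>Away from \<open>w\<close>, edges at \<open>u\<close> take colours in {3, 5} and
    edges at \<open>v\<close> colours in {4, 6}: disjoint palettes that also avoid 1 and 2.\<close>
  have c_u: "c {u, x} = (if (v, x) \<in> parcs G then 3 else 5)" "c {x, u} = c {u, x}"
    and c_v: "c {v, x} = (if (u, x) \<in> parcs G then 4 else 6)" "c {x, v} = c {v, x}"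
    if "x \<notin> {u, v, w}" for x
    using that facts sym[of v x] sym[of x v] sym[of u x] sym[of x u]
    by (auto simp: c_def doubleton_eq_iff insert_commute)
  note cols = c_uw c_wv c_u c_v
  have conn_uv: "conn u v"
  proof -
    have "rainbow_path G c u [(u, w), (w, v)] v"
      using facts by (simp add: rainbow_path_simps cols)
    then show ?thesis unfolding conn_def by blast
  qed
  have conn_u: "conn u y" if "y \<notin> {u, v, w}" "(v, y) \<in> parcs G" "(u, y) \<notin> parcs G" for y
  proof -
    have "rainbow_path G c u [(u, w), (w, v), (v, y)] y"
      using facts that vert by (auto simp: rainbow_path_simps cols)
    then show ?thesis unfolding conn_def by blast
  qed
  have conn_v: "conn v x" if "x \<notin> {u, v, w}" "(u, x) \<in> parcs G" "(v, x) \<notin> parcs G" for x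
  proof -
    have "rainbow_path G c v [(v, w), (w, u), (u, x)] x"
      using facts that vert by (auto simp: rainbow_path_simps cols)
    then show ?thesis unfolding conn_def by blast
  qed
  have conn_w: "conn w x" if "x \<notin> {u, v, w}" "(u, x) \<in> parcs G \<or> (v, x) \<in> parcs G" for x
  proof -
    have "rainbow_path G c w [(w, u), (u, x)] x \<or> rainbow_path G c w [(w, v), (v, x)] x"
      using facts that vert by (auto simp: rainbow_path_simps cols)
    then show ?thesis unfolding conn_def by blast
  qed
  \<comment> \<open>The longest paths needed: their colours are 3 or 5, then 1, 2, and finally 4 or
    6.\<close>
  have conn_uv_nbs: "conn x y"
    if "x \<notin> {u, v, w}" "y \<notin> {u, v, w}" "x \<noteq> y" "(u, x) \<in> parcs G" "(v, y) \<in> parcs G" for x y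
  proof -
    have "rainbow_path G c x [(x, u), (u, w), (w, v), (v, y)] y"
      using facts that vert sym[of u x] by (auto simp: rainbow_path_simps cols)
    then show ?thesis unfolding conn_def by blast
  qed
  have conn_all: "conn x y" if x: "x \<in> pverts G" and y: "y \<in> pverts G" for x y
  proof (cases "x = y \<or> (x, y) \<in> parcs G")
    case True
    moreover have "conn x x"
      using x rainbow_path_simps(1) unfolding conn_def by blast
    ultimately show ?thesis using conn_arc by blast
  next
    case False
    have nb: "(u, z) \<in> parcs G \<or> (v, z) \<in> parcs G" if "z \<in> pverts G" "z \<notin> {u, v}" for z
      using indep[of u v z] that facts by auto
    have special: "conn a b" if "a \<in> {u, v, w}" "b \<in> pverts G" "a \<noteq> b" "(a, b) \<notin> parcs G" for a b
      using that nb[of b] conn_uv conn_sym[OF conn_uv] conn_u[of b] conn_v[of b] conn_w[of b]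
        conn_arc sym facts by blast
    consider "x \<in> {u, v, w}" | "y \<in> {u, v, w}" | "x \<notin> {u, v, w}" "y \<notin> {u, v, w}" by blast
    then show ?thesis
    proof cases
      case 1
      then show ?thesis using special y False by blast
    next
      case 2
      then show ?thesis using special[of y x] x False sym conn_sym by blast
    next
      case 3
      then have "(u, x) \<in> parcs G \<or> (v, x) \<in> parcs G" "(u, y) \<in> parcs G \<or> (v, y) \<in> parcs G"
        using nb x y by auto
      \<comment> \<open>Each of \<open>x\<close>, \<open>y\<close> has a neighbour in
        \<open>{u, v}\<close> and each of \<open>u\<close>, \<open>v\<close> one in
        \<open>{x, y}\<close>. This forces a perfect matching between the two pairs, giving the ends
        of the path through \<open>u\<close>, \<open>w\<close>, \<open>v\<close>.\<close>
      moreover have "(u, x) \<in> parcs G \<or> (u, y) \<in> parcs G" "(v, x) \<in> parcs G \<or> (v, y) \<in> parcs G"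
        using indep[of u x y] indep[of v x y] 3 x y False facts by auto
      ultimately show ?thesis
        using conn_uv_nbs[of x y] conn_sym[OF conn_uv_nbs[of y x]] 3 False by blast
    qed
  qed
  have "edge_coloring G 6 c"
    unfolding edge_coloring_def c_def by auto
  moreover have "rainbow_connected G c"
    using conn_all unfolding rainbow_connected_def conn_def by blast
  ultimately show ?thesis by blast
qed

text \<open>Paths with at most one edge are rainbow under any colouring.\<close>

lemma rainbow_connected_complete:
  assumes "\<And>x y. x \<in> pverts G \<Longrightarrow> y \<in> pverts G \<Longrightarrow> x \<noteq> y \<Longrightarrow> (x, y) \<in> parcs G"
  shows "rainbow_connected G c"
  unfolding rainbow_connected_def
proof (intro ballI)
  fix x y assume xy: "x \<in> pverts G" "y \<in> pverts G"
  then have "rainbow_path G c x (if x = y then [] else [(x, y)]) y"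
    using assms by (auto simp: rainbow_path_simps)
  then show "\<exists>p. rainbow_path G c x p y" by blast
qed

end

theorem theorem1p2:
  fixes G :: "'a pair_pre_digraph"
  assumes "pair_graph G"
    and "card (pverts G) \<ge> 2"
    and "Digraph_Component.connected (with_proj G)"
    and "triangle_free (complement G)"
  shows "rc G \<le> 6"
proof -
  interpret pair_graph G by fact
  have "\<exists>c. edge_coloring G 6 c \<and> rainbow_connected G c"
  proof (cases "\<forall>x\<in>pverts G. \<forall>y\<in>pverts G. x \<noteq> y \<longrightarrow> (x, y) \<in> parcs G")
    case True
    then have "rainbow_connected G (\<lambda>_. 1)"
      using rainbow_connected_complete by blast
    moreover have "edge_coloring G 6 (\<lambda>_. 1)"
      by (auto simp: edge_coloring_def)
    ultimately show ?thesis by blast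
  next
    case False
    then obtain u w v where "(u, w) \<in> parcs G" "(w, v) \<in> parcs G" "u \<noteq> v" "(u, v) \<notin> parcs G"
      using connected_obtain_common_neighbour[OF assms(3)] by blast
    then show ?thesis
      using rainbow_connected_six_colours[OF assms(4)] by blast
  qed
  then show ?thesis unfolding rc_def by (rule Least_le)
qed

end
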